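(* Let $\boldsymbol{\mathcal A},\boldsymbol{\mathcal B},\boldsymbol{\mathcal D},K,\boldsymbol\mu_0,\mathbf\Sigma_0$ be as in the context, and assume $\Sigma_0\succeq 0$. Let $$\bar{\mathbf X}=(I+\boldsymbol{\mathcal B}K)\boldsymbol{\mathcal A}\boldsymbol\mu_0,\qquad \Sigma_{\mathbf X}=(I+\boldsymbol{\mathcal B}K)(\boldsymbol{\mathcal A}\mathbf\Sigma_0\boldsymbol{\mathcal A}^\top+\boldsymbol{\mathcal D}\boldsymbol{\mathcal D}^\top)(I+\boldsymbol{\mathcal B}K)^\top .$$ Let $\alpha_j\in\mathbb R^{(N+2)n_x}$, $\beta_j\in\mathbb R$, $p_j\in(0,1)$. Then the inequality constraint $$\alpha_j^\top\bar{\mathbf X}-\beta_j+\sqrt{\alpha_j^\top\Sigma_{\mathbf X}\alpha_j}\;\Phi^{-1}(1-p_j)\le 0$$ is equivalent to the inequality constraint $$\alpha_j^\top(I+\boldsymbol{\mathcal B}K)\boldsymbol{\mathcal A}\boldsymbol\mu_0-\beta_j+\big\|(\boldsymbol{\mathcal A}\mathbf\Sigma_0\boldsymbol{\mathcal A}^\top+\boldsymbol{\mathcal D}\boldsymbol{\mathcal D}^\top)^{1/2}(I+\boldsymbol{\mathcal B}K)^\top\alpha_j\big\|\;\Phi^{-1}(1-p_j)\le 0 .$$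
   Context: Fix positive integers $N,n_x,n_u,n_w$ and real matrices $A_k\in\mathbb R^{n_x\times n_x}$, $B_k\in\mathbb R^{n_x\times n_u}$, $D_k\in\mathbb R^{n_x\times n_w}$, $k=0,\dots,N-1$ (the data of the linear system $x_{k+1}=A_kx_k+B_ku_k+D_kw_k$). Define $\mathcal A\in\mathbb R^{(N+1)n_x\times n_x}$, $\mathcal B\in\mathbb R^{(N+1)n_x\times Nn_u}$, $\mathcal D\in\mathbb R^{(N+1)n_x\times Nn_w}$ blockwise, with block rows $i=0,\dots,N$ and block columns $j=0,\dots,N-1$: the $i$-th block of $\mathcal A$ is $A_{i-1}A_{i-2}\cdots A_0$ (and $I_{n_x}$ for $i=0$); the $(i,j)$ block of $\mathcal B$ is $A_{i-1}A_{i-2}\cdots A_{j+1}B_j$ if $j<i$ (equal to $B_{i-1}$ if $j=i-1$) and $0$ if $j\ge i$; $\mathcal D$ is defined likewise with $D_j$ in place of $B_j$. So the system reads $X=\mathcal Ax_0+\mathcal BU+\mathcal DW$, with $X,U,W$ the stacked states $x_0,\dots,x_N$, inputs $u_0,\dots,u_{N-1}$ and noises $w_0,\dots,w_{N-1}$. Augmented matrices: $\boldsymbol{\mathcal A}=\mathrm{blkdiag}(I_{n_x},\mathcal A)\in\mathbb R^{(N+2)n_x\times 2n_x}$, $\boldsymbol{\mathcal B}=\begin{bmatrix}0\\ \mathcal B\end{bmatrix}\in\mathbb R^{(N+2)n_x\times Nn_u}$, $\boldsymbol{\mathcal D}=\begin{bmatrix}0\\ \mathcal D\end{bmatrix}\in\mathbb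 R^{(N+2)n_x\times Nn_w}$, where the zero blocks have $n_x$ rows. $\mu_0\in\mathbb R^{n_x}$ and $\Sigma_0\in\mathbb R^{n_x\times n_x}$ (symmetric) are the mean and covariance of the initial state, and $\boldsymbol\mu_0=\begin{bmatrix}\mathbb 1_{n_x}\\ \mu_0\end{bmatrix}$, $\mathbf\Sigma_0=\begin{bmatrix}0&0\\0&\Sigma_0\end{bmatrix}\in\mathbb R^{2n_x\times 2n_x}$, with $\mathbb 1_{n_x}$ the all-ones vector. $K=[K_{\mathbb 1},K_X]\in\mathbb R^{Nn_u\times(N+2)n_x}$ is the control gain matrix, with $K_{\mathbb 1}\in\mathbb R^{Nn_u\times n_x}$ and $K_X\in\mathbb R^{Nn_u\times(N+1)n_x}$ lower block triangular (blocks of size $n_u\times n_x$; block $(i,j)$ is zero for $j>i$). $\Phi$ is the cumulative distribution function of the standard normal distribution and $\Phi^{-1}$ its inverse; $M^{1/2}$ is the symmetric positive semidefinite square root of $M\succeq0$; $\|\cdot\|$ is the Euclidean norm. $\bar{\mathbf X}$ and $\Sigma_{\mathbf X}$ are the mean and covariance of the augmented state $\mathbf X=[\mathbb 1_{n_x}^\top,X^\top]^\top$; the first inequality is the deterministic form of the chance constraint $\Pr(\alpha_j^\top\mathbf X>\beta_j)\le p_j$. *)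

theory Defs
  imports "HOL-Probability.Probability" "Jordan_Normal_Form.Matrix"
begin

unbundle no inner_syntax

text \<open>All blocks of \<open>mat_of_blocks R C r c F\<close> have size \<open>r \<times> c\<close>; block rows
  and block columns are numbered from 0.\<close>

definition mat_of_blocks ::
  "nat \<Rightarrow> nat \<Rightarrow> nat \<Rightarrow> nat \<Rightarrow> (nat \<Rightarrow> nat \<Rightarrow> real mat) \<Rightarrow> real mat" where
  "mat_of_blocks R C r c F =
     mat (R * r) (C * c) (\<lambda>(a, b). F (a div r) (b div c) $$ (a mod r, b mod c))"

definition mat_block :: "nat \<Rightarrow> nat \<Rightarrow> real mat \<Rightarrow> nat \<Rightarrow> nat \<Rightarrow> real mat" where
  "mat_block r c M i j = mat r c (\<lambda>(a, b). M $$ (i * r + a, j * c + b))"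

definition lower_block_triangular ::
  "nat \<Rightarrow> nat \<Rightarrow> nat \<Rightarrow> nat \<Rightarrow> real mat \<Rightarrow> bool" where
  "lower_block_triangular R C r c M \<longleftrightarrow>
     (\<forall>i<R. \<forall>j<C. i < j \<longrightarrow> mat_block r c M i j = 0\<^sub>m r c)"

definition append_cols :: "real mat \<Rightarrow> real mat \<Rightarrow> real mat" where
  "append_cols M L = four_block_mat M L (0\<^sub>m 0 (dim_col M)) (0\<^sub>m 0 (dim_col L))"

text \<open>\<open>transition n A j i\<close> is the product \<open>A (i - 1) * A (i - 2) * \<dots> * A j\<close> of
  \<open>n \<times> n\<close> matrices, and the identity if \<open>i \<le> j\<close>.\<close>

primrec transition :: "nat \<Rightarrow> (nat \<Rightarrow> real mat) \<Rightarrow> nat \<Rightarrow> nat \<Rightarrow> real mat" where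
  "transition n A j 0 = 1\<^sub>m n"
| "transition n A j (Suc i) = (if j \<le> i then A i * transition n A j i else 1\<^sub>m n)"

definition stacked_state_mat :: "nat \<Rightarrow> nat \<Rightarrow> (nat \<Rightarrow> real mat) \<Rightarrow> real mat" where
  "stacked_state_mat N nx A = mat_of_blocks (N + 1) 1 nx nx (\<lambda>i j. transition nx A 0 i)"

text \<open>Used both for the inputs (with \<open>B\<close>, \<open>m\<close> the input dimension) and for the noises
  (with \<open>D\<close>, \<open>m\<close> the noise dimension).\<close>

definition stacked_input_mat ::
  "nat \<Rightarrow> nat \<Rightarrow> nat \<Rightarrow> (nat \<Rightarrow> real mat) \<Rightarrow> (nat \<Rightarrow> real mat) \<Rightarrow> real mat" where
  "stacked_input_mat N nx m A B = mat_of_blocks (N + 1) N nx m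
     (\<lambda>i j. if j < i then transition nx A (j + 1) i * B j else 0\<^sub>m nx m)"

definition aug_state_mat :: "nat \<Rightarrow> nat \<Rightarrow> (nat \<Rightarrow> real mat) \<Rightarrow> real mat" where
  "aug_state_mat N nx A = diag_block_mat [1\<^sub>m nx, stacked_state_mat N nx A]"

definition aug_input_mat ::
  "nat \<Rightarrow> nat \<Rightarrow> nat \<Rightarrow> (nat \<Rightarrow> real mat) \<Rightarrow> (nat \<Rightarrow> real mat) \<Rightarrow> real mat" where
  "aug_input_mat N nx m A B = 0\<^sub>m nx (N * m) @\<^sub>r stacked_input_mat N nx m A B"

definition aug_mean :: "nat \<Rightarrow> real vec \<Rightarrow> real vec" where
  "aug_mean nx \<mu> = vec nx (\<lambda>_. 1) @\<^sub>v \<mu>"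

definition aug_cov :: "nat \<Rightarrow> real mat \<Rightarrow> real mat" where
  "aug_cov nx \<Sigma> = four_block_mat (0\<^sub>m nx nx) (0\<^sub>m nx nx) (0\<^sub>m nx nx) \<Sigma>"

definition psd_mat :: "real mat \<Rightarrow> bool" where
  "psd_mat M \<longleftrightarrow> square_mat M \<and> transpose_mat M = M \<and>
     (\<forall>v \<in> carrier_vec (dim_row M). 0 \<le> v \<bullet> (M *\<^sub>v v))"

text \<open>Meaningful for \<open>psd_mat M\<close>, where the square root exists and is unique.\<close>

definition psd_sqrt :: "real mat \<Rightarrow> real mat" where
  "psd_sqrt M = (THE S. psd_mat S \<and> S * S = M)"

definition vec_norm2 :: "real vec \<Rightarrow> real" where
  "vec_norm2 v = L2_set (($) v) {..<dim_vec v}"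

definition std_normal_cdf :: "real \<Rightarrow> real" where
  "std_normal_cdf = cdf std_normal_distribution"

text \<open>The distribution function is a bijection from the reals onto the open unit interval;
  the inverse is only meaningful there.\<close>

definition std_normal_quantile :: "real \<Rightarrow> real" where
  "std_normal_quantile = the_inv std_normal_cdf"

end

(* The quadratic form of Sigma_X at alpha is that of M = A Sigma_0 A^T + D D^T at
   v = (I + B K)^T alpha. M is positive semidefinite, so v . M v = (M^(1/2) v) . (M^(1/2) v),
   and the two left-hand sides are equal. As the square root is given by a definite description,
   its existence and uniqueness must be proved: existence comes from the spectral theorem; for
   uniqueness, if S^2 = T^2 and S u = c u with c >= 0, then w = T u - c u satisfies T w = - c w,
   hence c |w|^2 = 0. So w = 0 if c > 0, and if c = 0 then |w|^2 = u . T T u = 0 as well: T agrees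
   with S on an eigenbasis of S. *)

theory Submission
  imports Defs "Jordan_Normal_Form.Spectral_Radius"
begin

unbundle no vec_syntax

section \<open>Spectral theorem for real symmetric matrices\<close>

lemma symmetric_mat_has_eigenvector:
  fixes M :: "real mat"
  assumes M: "M \<in> carrier_mat n n" and sym: "transpose_mat M = M" and n: "n > 0"
  obtains v e where "v \<in> carrier_vec n" "v \<noteq> 0\<^sub>v n" "M *\<^sub>v v = e \<cdot>\<^sub>v v"
proof -
  \<comment> \<open>Over the complex numbers the spectrum is nonempty. The real and imaginary parts
    x and y of a complex eigenvector w satisfy a coupled real system, from which symmetry removes
    the coupling constant Im l.\<close>
  define C where "C = map_mat complex_of_real M"
  have C: "C \<in> carrier_mat n n" using M by (simp add: C_def)
  obtain l w where w: "w \<in> carrier_vec n" "w \<noteq> 0\<^sub>v n" "C *\<^sub>v w = l \<cdot>\<^sub>v w"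
    using spectrum_non_empty[OF C n] C
    unfolding spectrum_def eigenvalue_def eigenvector_def by auto
  define x where "x = map_vec Re w"
  define y where "y = map_vec Im w"
  have xc: "x \<in> carrier_vec n" and yc: "y \<in> carrier_vec n" using w(1) by (auto simp: x_def y_def)
  have comp: "(\<Sum>j<n. complex_of_real (M $$ (i,j)) * w $ j) = l * w $ i" if "i < n" for i
  proof -
    have "(C *\<^sub>v w) $ i = (\<Sum>j<n. complex_of_real (M $$ (i,j)) * w $ j)"
      using that w(1) M by (auto simp: C_def scalar_prod_def lessThan_atLeast0)
    then show ?thesis using w that by auto
  qed
  have Mx: "M *\<^sub>v x = Re l \<cdot>\<^sub>v x - Im l \<cdot>\<^sub>v y"
  proof (rule eq_vecI)
    fix i assume "i < dim_vec (Re l \<cdot>\<^sub>v x - Im l \<cdot>\<^sub>v y)"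
    then have i: "i < n" using yc by simp
    have "(M *\<^sub>v x) $ i = Re (\<Sum>j<n. complex_of_real (M $$ (i,j)) * w $ j)"
      using i w(1) M by (auto simp: x_def scalar_prod_def lessThan_atLeast0)
    then show "(M *\<^sub>v x) $ i = (Re l \<cdot>\<^sub>v x - Im l \<cdot>\<^sub>v y) $ i"
      using comp[OF i] i w(1) by (simp add: x_def y_def)
  qed (use M yc in auto)
  have My: "M *\<^sub>v y = Re l \<cdot>\<^sub>v y + Im l \<cdot>\<^sub>v x"
  proof (rule eq_vecI)
    fix i assume "i < dim_vec (Re l \<cdot>\<^sub>v y + Im l \<cdot>\<^sub>v x)"
    then have i: "i < n" using xc by simp
    have "(M *\<^sub>v y) $ i = Im (\<Sum>j<n. complex_of_real (M $$ (i,j)) * w $ j)"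
      using i w(1) M by (auto simp: y_def scalar_prod_def lessThan_atLeast0)
    then show "(M *\<^sub>v y) $ i = (Re l \<cdot>\<^sub>v y + Im l \<cdot>\<^sub>v x) $ i"
      using comp[OF i] i w(1) by (simp add: x_def y_def)
  qed (use M xc in auto)
  have xy: "x \<noteq> 0\<^sub>v n \<or> y \<noteq> 0\<^sub>v n"
  proof (rule ccontr)
    assume "\<not> ?thesis"
    then have "\<forall>i<n. x $ i = 0 \<and> y $ i = 0" by auto
    then have "w = 0\<^sub>v n" using w(1) by (intro eq_vecI) (auto simp: x_def y_def complex_eq_iff)
    with w(2) show False by simp
  qed
  have pos: "z \<bullet> z \<ge> 0" "z \<bullet> z = 0 \<longleftrightarrow> z = 0\<^sub>v n" if "z \<in> carrier_vec n" for z :: "real vec"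
    using conjugate_square_eq_0_vec[OF that] conjugate_square_ge_0_vec[of z] by auto
  \<comment> \<open>By symmetry x . M y = M x . y. The terms Re l (x . y) cancel, which leaves Im l
    (|x|^2 + |y|^2) = 0. Hence l is real, and whichever of x, y is nonzero is a real
    eigenvector.\<close>
  have "x \<bullet> (M *\<^sub>v y) = (M *\<^sub>v x) \<bullet> y"
    using transpose_vec_mult_scalar[OF M yc xc] sym by simp
  then have "Im l * (x \<bullet> x) = - Im l * (y \<bullet> y)"
    unfolding Mx My using xc yc
    by (simp add: scalar_prod_add_distrib[of _ n] minus_scalar_prod_distrib[of _ n])
  then have "Im l * (x \<bullet> x + y \<bullet> y) = 0" by (simp add: algebra_simps)
  moreover have "x \<bullet> x + y \<bullet> y \<noteq> 0"
    using xy pos[OF xc] pos[OF yc] by (auto simp: add_nonneg_eq_0_iff)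
  ultimately have "Im l = 0" by simp
  then have "M *\<^sub>v x = Re l \<cdot>\<^sub>v x" "M *\<^sub>v y = Re l \<cdot>\<^sub>v y"
    using Mx My xc yc by auto
  with xy xc yc that show thesis by blast
qed

text \<open>Gram-Schmidt keeps the first vector of a basis that starts with v, and normalising the
  result gives orthonormal columns. The factor c absorbs the normalisation of v. The matrix serves
  to rotate an eigenvector into the first coordinate.\<close>

lemma orthogonal_mat_with_first_col:
  fixes v :: "real vec"
  assumes v: "v \<in> carrier_vec n" "v \<noteq> 0\<^sub>v n"
  obtains W c where "W \<in> carrier_mat n n" "transpose_mat W * W = 1\<^sub>m n" "col W 0 = c \<cdot>\<^sub>v v"
proof -
  interpret cof_vec_space n "TYPE(real)" .
  define b where "b = basis_completion v"
  define ws where "ws = gram_schmidt n b"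
  from basis_completion[OF v, folded b_def]
  have dist_b: "distinct b" and indep: "\<not> lin_dep (set b)" and b: "set b \<subseteq> carrier_vec n"
    and hdb: "hd b = v" and len_b: "length b = n" by auto
  from gram_schmidt_result[OF b dist_b indep refl, folded ws_def]
  have ws: "set ws \<subseteq> carrier_vec n" "corthogonal ws" "length ws = n" by (auto simp: len_b)
  have n: "n > 0"
  proof (rule ccontr)
    assume "\<not> n > 0"
    then have "v = 0\<^sub>v n" using v(1) by (intro eq_vecI) auto
    with v(2) show False by simp
  qed
  then obtain vs where bv: "b = v # vs" using hdb len_b by (cases b) auto
  from gram_schmidt_hd[OF v(1), of vs, folded bv] have hdws: "hd ws = v" unfolding ws_def .
  define us where "us = map (\<lambda>w. (1 / sqrt (w \<bullet> w)) \<cdot>\<^sub>v w) ws"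
  define W where "W = mat_of_cols n us"
  have W: "W \<in> carrier_mat n n" using ws by (simp add: W_def us_def mat_of_cols_def)
  have wsc: "ws ! i \<in> carrier_vec n" if "i < n" for i using ws that by auto
  have colW: "col W i = (1 / sqrt (ws ! i \<bullet> ws ! i)) \<cdot>\<^sub>v ws ! i" if "i < n" for i
    using that ws wsc[OF that] unfolding W_def us_def by (subst col_mat_of_cols) auto
  \<comment> \<open>Conjugation is trivial on the reals, so \<open>corthogonal\<close> is ordinary
    orthogonality. The case i = j says that no ws ! i has length zero, which justifies dividing by
    the lengths.\<close>
  have dot: "(ws ! i \<bullet> ws ! j = 0) = (i \<noteq> j)" if "i < n" "j < n" for i j
    using corthogonalD[OF ws(2)] that ws(3) by simp
  have "transpose_mat W * W = 1\<^sub>m n"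
  proof (rule eq_matI)
    fix i j assume "i < dim_row (1\<^sub>m n :: real mat)" "j < dim_col (1\<^sub>m n :: real mat)"
    then have ij: "i < n" "j < n" by auto
    have "ws ! i \<bullet> ws ! i \<ge> 0" using conjugate_square_ge_0_vec[of "ws ! i"] by auto
    then have "sqrt (ws ! i \<bullet> ws ! i) * sqrt (ws ! i \<bullet> ws ! i) = ws ! i \<bullet> ws ! i" by simp
    then show "(transpose_mat W * W) $$ (i, j) = 1\<^sub>m n $$ (i, j)"
      using ij W dot[OF ij] wsc[OF ij(1)] wsc[OF ij(2)] by (auto simp: colW)
  qed (use W in auto)
  moreover have "ws ! 0 = v" using hdws ws(3) n by (cases ws) auto
  then have "col W 0 = (1 / sqrt (v \<bullet> v)) \<cdot>\<^sub>v v" using colW[OF n] by simp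
  ultimately show thesis using that W by blast
qed

text \<open>Eigenvalues are given as a function of the index, so that products and square roots can
  be taken pointwise.\<close>

definition diagonal :: "nat \<Rightarrow> (nat \<Rightarrow> real) \<Rightarrow> real mat" where
  "diagonal n d = mat n n (\<lambda>(i, j). if i = j then d i else 0)"

lemma diagonal_carrier [simp]: "diagonal n d \<in> carrier_mat n n"
  by (simp add: diagonal_def)

lemma transpose_diagonal [simp]: "transpose_mat (diagonal n d) = diagonal n d"
  by (rule eq_matI) (auto simp: diagonal_def)

lemma diagonal_mult_vec:
  "v \<in> carrier_vec n \<Longrightarrow> diagonal n d *\<^sub>v v = vec n (\<lambda>i. d i * v $ i)"
  by (rule eq_vecI)
    (auto simp: diagonal_def scalar_prod_def if_distrib[where f = "\<lambda>x. x * _"] cong: if_cong)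

lemma diagonal_mult_diagonal: "diagonal n d * diagonal n f = diagonal n (\<lambda>i. d i * f i)"
  by (rule eq_matI)
    (auto simp: diagonal_def scalar_prod_def if_distrib[where f = "\<lambda>x. x * _"] cong: if_cong)

text \<open>Deflation: in an orthonormal basis that starts with an eigenvector, symmetry makes the
  matrix block diagonal with blocks of size 1 and n, and the induction hypothesis diagonalises the
  second block.\<close>

lemma spectral_theorem:
  fixes M :: "real mat"
  assumes "M \<in> carrier_mat n n" "transpose_mat M = M"
  shows "\<exists>U d. U \<in> carrier_mat n n \<and> transpose_mat U * U = 1\<^sub>m n
    \<and> transpose_mat U * M * U = diagonal n d"
  using assms
proof (induction n arbitrary: M)
  case 0
  then show ?case by (intro exI[of _ M] exI[of _ "\<lambda>_. 0"]) (auto simp: diagonal_def intro!: eq_matI)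
next
  case (Suc n)
  note M = Suc.prems(1)
  obtain v e where v: "v \<in> carrier_vec (Suc n)" "v \<noteq> 0\<^sub>v (Suc n)" "M *\<^sub>v v = e \<cdot>\<^sub>v v"
    using symmetric_mat_has_eigenvector[OF Suc.prems] by auto
  obtain W c where W: "W \<in> carrier_mat (Suc n) (Suc n)" and WW: "transpose_mat W * W = 1\<^sub>m (Suc n)"
    and W0: "col W 0 = c \<cdot>\<^sub>v v"
    using orthogonal_mat_with_first_col[OF v(1,2)] .
  define M' where "M' = transpose_mat W * M * W"
  have M': "M' \<in> carrier_mat (Suc n) (Suc n)" using M W by (simp add: M'_def)
  have M'sym: "transpose_mat M' = M'"
    using M W Suc.prems(2) by (simp add: M'_def transpose_mult[of _ "Suc n" "Suc n" _ "Suc n"])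
  have MW0: "M *\<^sub>v col W 0 = e \<cdot>\<^sub>v col W 0"
    using v M unfolding W0 by (simp add: mult_mat_vec[OF M v(1)] smult_smult_assoc mult.commute)
  \<comment> \<open>The first column of M' is e times the first column of W^T W = 1. The first row
    then follows from the symmetry of M'.\<close>
  have M'0: "M' $$ (i, 0) = (if i = 0 then e else 0)" if "i < Suc n" for i
  proof -
    have "M' $$ (i, 0) = (transpose_mat W * (M * W)) $$ (i, 0)"
      using M W by (simp add: M'_def)
    also have "\<dots> = col W i \<bullet> (M *\<^sub>v col W 0)" using M W that by simp
    also have "\<dots> = e * (col W i \<bullet> col W 0)" unfolding MW0 using W that by simp
    also have "col W i \<bullet> col W 0 = (transpose_mat W * W) $$ (i, 0)" using W that by simp
    finally show ?thesis using that by (simp add: WW)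
  qed
  have M'0': "M' $$ (0, i) = (if i = 0 then e else 0)" if "i < Suc n" for i
    using M'0[OF that] arg_cong[OF M'sym, of "\<lambda>A. A $$ (0, i)"] M' that by simp
  define L where "L = mat n n (\<lambda>(i, j). M' $$ (Suc i, Suc j))"
  have L: "L \<in> carrier_mat n n" by (simp add: L_def)
  have Lsym: "transpose_mat L = L"
  proof (rule eq_matI)
    fix i j assume "i < dim_row L" "j < dim_col L"
    then have ij: "i < n" "j < n" using L by auto
    show "transpose_mat L $$ (i, j) = L $$ (i, j)"
      using ij arg_cong[OF M'sym, of "\<lambda>A. A $$ (Suc i, Suc j)"] M' by (simp add: L_def)
  qed (use L in auto)
  have block: "M' = four_block_mat (e \<cdot>\<^sub>m 1\<^sub>m 1) (0\<^sub>m 1 n) (0\<^sub>m n 1) L"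
    using M' by (intro eq_matI) (auto simp: L_def M'0 M'0')
  obtain V d where V: "V \<in> carrier_mat n n" and VV: "transpose_mat V * V = 1\<^sub>m n"
    and VLV: "transpose_mat V * L * V = diagonal n d"
    using Suc.IH[OF L Lsym] by blast
  \<comment> \<open>P fixes the first coordinate and acts as V on the others, so it diagonalises M'
    and leaves the entry e alone. The orthogonal matrix sought is W * P.\<close>
  define P where "P = four_block_mat (1\<^sub>m 1) (0\<^sub>m 1 n) (0\<^sub>m n 1) V"
  have P: "P \<in> carrier_mat (Suc n) (Suc n)"
    using four_block_carrier_mat[of "1\<^sub>m 1" 1 1 V n n] V by (simp add: P_def)
  have Pt: "transpose_mat P = four_block_mat (1\<^sub>m 1) (0\<^sub>m 1 n) (0\<^sub>m n 1) (transpose_mat V)"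
    unfolding P_def by (subst transpose_four_block_mat[of _ 1 1 _ n _ n]) (use V in auto)
  have PP: "transpose_mat P * P = 1\<^sub>m (Suc n)"
    unfolding Pt unfolding P_def using V
    by (subst mult_four_block_mat[of _ 1 1 _ n _ n]) (auto simp: VV)
  have "transpose_mat P * M' * P
      = four_block_mat (e \<cdot>\<^sub>m 1\<^sub>m 1) (0\<^sub>m 1 n) (0\<^sub>m n 1) (transpose_mat V * L * V)"
    unfolding Pt block unfolding P_def using V L
    by (subst mult_four_block_mat[of _ 1 1 _ n _ n], auto)
      (subst mult_four_block_mat[of _ 1 1 _ n _ n], auto)
  \<comment> \<open>The eigenvalue e comes first and those of L are shifted by one index.\<close>
  also have "\<dots> = diagonal (Suc n) (\<lambda>i. case i of 0 \<Rightarrow> e | Suc k \<Rightarrow> d k)"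
    unfolding VLV by (rule eq_matI) (auto simp: diagonal_def split: nat.split)
  finally have diag: "transpose_mat P * M' * P = \<dots>" .
  note sq = assoc_mult_mat[of _ "Suc n" "Suc n" _ "Suc n" _ "Suc n"]
    mult_carrier_mat[of _ "Suc n" "Suc n" _ "Suc n"]
  have "transpose_mat (W * P) = transpose_mat P * transpose_mat W"
    by (rule transpose_mult[OF W P])
  moreover have "transpose_mat P * transpose_mat W * (W * P)
      = transpose_mat P * (transpose_mat W * W) * P"
    using W P by (simp add: sq)
  moreover have "transpose_mat P * transpose_mat W * M * (W * P)
      = transpose_mat P * M' * P"
    using W P M by (simp add: M'_def sq)
  ultimately have "transpose_mat (W * P) * (W * P) = 1\<^sub>m (Suc n)"
    "transpose_mat (W * P) * M * (W * P)
      = diagonal (Suc n) (\<lambda>i. case i of 0 \<Rightarrow> e | Suc k \<Rightarrow> d k)"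
    using P PP WW diag right_mult_one_mat[of "transpose_mat P" "Suc n" "Suc n"] by simp_all
  with mult_carrier_mat[OF W P] show ?case by blast
qed


section \<open>Positive semidefinite matrices\<close>

lemma psd_matI:
  assumes "M \<in> carrier_mat n n" "transpose_mat M = M"
    and "\<And>v. v \<in> carrier_vec n \<Longrightarrow> 0 \<le> v \<bullet> (M *\<^sub>v v)"
  shows "psd_mat M"
  using assms by (auto simp: psd_mat_def)

lemma psd_matD:
  assumes "psd_mat M" "M \<in> carrier_mat n n"
  shows "transpose_mat M = M" "v \<in> carrier_vec n \<Longrightarrow> 0 \<le> v \<bullet> (M *\<^sub>v v)"
  using assms by (auto simp: psd_mat_def)

lemma psd_mat_carrier: "psd_mat M \<Longrightarrow> M \<in> carrier_mat (dim_row M) (dim_row M)"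
  by (auto simp: psd_mat_def)

text \<open>The form of G M G^T at v is the form of M at G^T v. As G may be rectangular, this covers
  the propagated covariance as well as a change of basis.\<close>

lemma psd_mat_congruence:
  assumes M: "M \<in> carrier_mat n n" "psd_mat M" and G: "G \<in> carrier_mat m n"
  shows "psd_mat (G * M * transpose_mat G)"
proof (rule psd_matI)
  show "G * M * transpose_mat G \<in> carrier_mat m m" using M G by simp
  show "transpose_mat (G * M * transpose_mat G) = G * M * transpose_mat G"
    using M(1) G psd_matD(1)[OF M(2,1)]
    by (simp add: transpose_mult[of _ m n _ m] transpose_mult[of _ n n _ m]
        assoc_mult_mat[of _ m n _ n _ m])
  fix v :: "real vec" assume v: "v \<in> carrier_vec m"
  have Gv: "transpose_mat G *\<^sub>v v \<in> carrier_vec n" using G v by simp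
  have "v \<bullet> (G * M * transpose_mat G *\<^sub>v v) = v \<bullet> (G *\<^sub>v (M *\<^sub>v (transpose_mat G *\<^sub>v v)))"
    using M(1) G v Gv by (simp add: assoc_mult_mat_vec[of _ m n _ m] assoc_mult_mat_vec[of _ m n _ n])
  also have "\<dots> = (transpose_mat G *\<^sub>v v) \<bullet> (M *\<^sub>v (transpose_mat G *\<^sub>v v))"
    using transpose_vec_mult_scalar[OF G _ v] M(1) Gv by simp
  finally show "0 \<le> v \<bullet> (G * M * transpose_mat G *\<^sub>v v)"
    using psd_matD(2)[OF M(2,1) Gv] by simp
qed

lemma psd_mat_add:
  assumes "M \<in> carrier_mat n n" "psd_mat M" "L \<in> carrier_mat n n" "psd_mat L"
  shows "psd_mat (M + L)"
  using assms psd_matD[OF assms(2,1)] psd_matD[OF assms(4,3)]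
  by (intro psd_matI[of _ n])
    (auto simp: transpose_add[of _ n n] add_mult_distrib_mat_vec[of _ n n] scalar_prod_add_distrib[of _ n])

lemma psd_mat_diagonal:
  assumes "\<And>i. i < n \<Longrightarrow> 0 \<le> d i"
  shows "psd_mat (diagonal n d)"
proof (rule psd_matI)
  fix v :: "real vec" assume v: "v \<in> carrier_vec n"
  then have "v \<bullet> (diagonal n d *\<^sub>v v) = (\<Sum>i<n. d i * (v $ i)\<^sup>2)"
    by (simp add: diagonal_mult_vec scalar_prod_def lessThan_atLeast0 power2_eq_square algebra_simps)
  then show "0 \<le> v \<bullet> (diagonal n d *\<^sub>v v)" using assms by (auto intro!: sum_nonneg)
qed auto

lemma psd_mat_mult_transpose:
  assumes G: "G \<in> carrier_mat m n"
  shows "psd_mat (G * transpose_mat G)"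
proof -
  \<comment> \<open>G G^T is the congruence of the identity by G, and the identity is a nonnegative
    diagonal matrix.\<close>
  have "diagonal n (\<lambda>_. 1) = 1\<^sub>m n" by (rule eq_matI) (auto simp: diagonal_def)
  then have "psd_mat (1\<^sub>m n)" using psd_mat_diagonal[of n "\<lambda>_. 1"] by simp
  then show ?thesis using psd_mat_congruence[OF one_carrier_mat _ G] G by simp
qed

text \<open>A left inverse of a square matrix is also a right inverse, so U^T M U = D can be solved
  for M. Each d i is the quadratic form of M at the i-th column of U, hence nonnegative.\<close>

lemma psd_mat_spectral_decomposition:
  assumes M: "M \<in> carrier_mat n n" "psd_mat M"
  obtains U d where "U \<in> carrier_mat n n" "transpose_mat U * U = 1\<^sub>m n"
    "M = U * diagonal n d * transpose_mat U" "\<And>i. i < n \<Longrightarrow> 0 \<le> d i"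
proof -
  obtain U d where U: "U \<in> carrier_mat n n" and UU: "transpose_mat U * U = 1\<^sub>m n"
    and D: "transpose_mat U * M * U = diagonal n d"
    using spectral_theorem[OF M(1) psd_matD(1)[OF M(2,1)]] by blast
  have UU': "U * transpose_mat U = 1\<^sub>m n"
    using mat_mult_left_right_inverse[OF _ U UU] U by simp
  have "U * diagonal n d * transpose_mat U
      = (U * transpose_mat U) * M * (U * transpose_mat U)"
    unfolding D[symmetric] using U M(1)
    by (simp add: assoc_mult_mat[of _ n n _ n _ n])
  then have "M = U * diagonal n d * transpose_mat U" using M(1) by (simp add: UU')
  moreover have "0 \<le> d i" if "i < n" for i
  proof -
    have "d i = (transpose_mat U * (M * U)) $$ (i, i)"
      using arg_cong[OF D, of "\<lambda>A. A $$ (i, i)"] U M(1) that by (simp add: diagonal_def)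
    also have "\<dots> = col U i \<bullet> (M *\<^sub>v col U i)" using U M(1) that by simp
    finally show ?thesis using psd_matD(2)[OF M(2,1), of "col U i"] U that by simp
  qed
  ultimately show thesis using that U UU by blast
qed

section \<open>Uniqueness and existence of the positive semidefinite square root\<close>

lemma psd_mat_eq_if_square_eq:
  assumes S: "S \<in> carrier_mat n n" "psd_mat S" and T: "T \<in> carrier_mat n n" "psd_mat T"
    and eq: "S * S = T * T"
  shows "S = T"
proof -
  obtain U d where U: "U \<in> carrier_mat n n" and UU: "transpose_mat U * U = 1\<^sub>m n"
    and S_eq: "S = U * diagonal n d * transpose_mat U" and d: "\<And>i. i < n \<Longrightarrow> 0 \<le> d i"
    using psd_mat_spectral_decomposition[OF S] by blast
  have UU': "U * transpose_mat U = 1\<^sub>m n"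
    using mat_mult_left_right_inverse[OF _ U UU] U by simp
  have SU: "S * U = U * diagonal n d" using U UU
    by (simp add: S_eq assoc_mult_mat[of _ n n _ n _ n] mult_carrier_mat[of _ n n _ n]
        right_mult_one_mat[of _ n n])
  have colS: "S *\<^sub>v col U j = d j \<cdot>\<^sub>v col U j" if j: "j < n" for j
  proof -
    have "S *\<^sub>v col U j = col (S * U) j" using S(1) U j by simp
    also have "\<dots> = d j \<cdot>\<^sub>v col U j"
      unfolding SU using U j
      by (intro eq_vecI) (auto simp: diagonal_def scalar_prod_def if_distrib[where f = "\<lambda>x. _ * x"] cong: if_cong)
    finally show ?thesis .
  qed
  have colT: "T *\<^sub>v u = c \<cdot>\<^sub>v u"
    if u: "u \<in> carrier_vec n" and c: "0 \<le> c" and Su: "S *\<^sub>v u = c \<cdot>\<^sub>v u" for u c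
  proof -
    have Tu: "T *\<^sub>v u \<in> carrier_vec n" using T(1) u by simp
    define w where "w = T *\<^sub>v u - c \<cdot>\<^sub>v u"
    have w: "w \<in> carrier_vec n" using u Tu by (simp add: w_def)
    have "T *\<^sub>v (T *\<^sub>v u) = S *\<^sub>v (S *\<^sub>v u)"
      using arg_cong[OF eq, of "\<lambda>A. A *\<^sub>v u"] S(1) T(1) u by simp
    also have "\<dots> = (c * c) \<cdot>\<^sub>v u" using S(1) u by (simp add: Su mult_mat_vec smult_smult_assoc)
    finally have TTu: "T *\<^sub>v (T *\<^sub>v u) = (c * c) \<cdot>\<^sub>v u" .
    \<comment> \<open>T T u = c^2 u factors as (T + c)(T - c) u = 0, and (T - c) u is w.\<close>
    have Tw: "T *\<^sub>v w = - c \<cdot>\<^sub>v w"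
    proof -
      have "T *\<^sub>v w = T *\<^sub>v (T *\<^sub>v u) - c \<cdot>\<^sub>v (T *\<^sub>v u)"
        unfolding w_def using T(1) u Tu by (simp add: mult_minus_distrib_mat_vec mult_mat_vec)
      then show ?thesis unfolding TTu w_def using u Tu T(1)
        by (intro eq_vecI) (auto simp: algebra_simps)
    qed
    have ww: "0 \<le> w \<bullet> w" and ww0: "w \<bullet> w = 0 \<longleftrightarrow> w = 0\<^sub>v n"
      using conjugate_square_eq_0_vec[OF w] conjugate_square_ge_0_vec[of w] by auto
    \<comment> \<open>Positivity of T at w bounds c |w|^2 above by 0, and c >= 0 bounds it
      below.\<close>
    have "0 \<le> - c * (w \<bullet> w)" using psd_matD(2)[OF T(2,1) w] w by (simp add: Tw)
    with c ww have "c * (w \<bullet> w) = 0" by (intro order_antisym) auto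
    \<comment> \<open>For c = 0 the equation c |w|^2 = 0 says nothing about w. Here w = T u, and
      moving T across the scalar product gives |w|^2 = u . T w = 0.\<close>
    moreover have "w \<bullet> w = 0" if "c = 0"
    proof -
      have weq: "w = T *\<^sub>v u" unfolding w_def using that u T(1) by (intro eq_vecI) auto
      have "w \<bullet> w = u \<bullet> (T *\<^sub>v w)"
        using transpose_vec_mult_scalar[OF T(1) w u] psd_matD(1)[OF T(2,1)] by (simp add: weq)
      also have "\<dots> = 0" using u w that by (simp add: Tw)
      finally show ?thesis .
    qed
    ultimately have "w = 0\<^sub>v n" using ww0 by auto
    moreover have "T *\<^sub>v u = w + c \<cdot>\<^sub>v u"
      unfolding w_def using u T(1) by (intro eq_vecI) auto
    ultimately show ?thesis using u by simp
  qed
  \<comment> \<open>S and T have the same action on every column of U; cancelling U on the right by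
    U U^T = 1 gives S = T.\<close>
  have "S * U = T * U"
  proof (rule mat_col_eqI)
    fix j assume "j < dim_col (T * U)"
    then have j: "j < n" using U by simp
    show "col (S * U) j = col (T * U) j"
      unfolding col_mult2[OF S(1) U j] col_mult2[OF T(1) U j] colS[OF j]
      using colT[OF _ d[OF j] colS[OF j]] U by (metis carrier_matD(1) col_dim)
  qed (use S(1) T(1) U in auto)
  then have "S * (U * transpose_mat U) = T * (U * transpose_mat U)"
    using assoc_mult_mat[OF S(1) U, of "transpose_mat U" n] assoc_mult_mat[OF T(1) U, of "transpose_mat U" n] U
    by (metis transpose_carrier_mat)
  then show ?thesis unfolding UU' using S(1) T(1) by (metis right_mult_one_mat)
qed

lemma psd_sqrt:
  assumes M: "M \<in> carrier_mat n n" "psd_mat M"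
  shows "psd_mat (psd_sqrt M)" "psd_sqrt M * psd_sqrt M = M" "psd_sqrt M \<in> carrier_mat n n"
proof -
  obtain U d where U: "U \<in> carrier_mat n n" and UU: "transpose_mat U * U = 1\<^sub>m n"
    and M_eq: "M = U * diagonal n d * transpose_mat U" and d: "\<And>i. i < n \<Longrightarrow> 0 \<le> d i"
    using psd_mat_spectral_decomposition[OF M] by blast
  \<comment> \<open>The witness takes the square root of each eigenvalue in the eigenbasis of
    M.\<close>
  define S where "S = U * diagonal n (\<lambda>i. sqrt (d i)) * transpose_mat U"
  have S: "S \<in> carrier_mat n n" using U by (simp add: S_def mult_carrier_mat[of _ n n _ n])
  have psdS: "psd_mat S"
    unfolding S_def using U d by (intro psd_mat_congruence psd_mat_diagonal) auto
  let ?R = "diagonal n (\<lambda>i. sqrt (d i))"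
  have "S * S = U * ?R * (transpose_mat U * U) * ?R * transpose_mat U"
    using U by (simp add: S_def assoc_mult_mat[of _ n n _ n _ n] mult_carrier_mat[of _ n n _ n])
  also have "\<dots> = U * (?R * ?R) * transpose_mat U" using U
    by (simp add: UU right_mult_one_mat[of _ n n] mult_carrier_mat[of _ n n _ n]
        assoc_mult_mat[of _ n n _ n _ n])
  \<comment> \<open>Squaring sqrt (d i) gives d i back because d i >= 0. This is known for i < n
    only, so the matrices are compared entrywise.\<close>
  also have "?R * ?R = diagonal n d"
    unfolding diagonal_mult_diagonal by (rule eq_matI) (auto simp: diagonal_def d)
  finally have SS: "S * S = M" by (simp add: M_eq)
  \<comment> \<open>The definite description ranges over matrices of any size. T * T = M fixes the
    number of rows of T, and \<open>psd_mat\<close> makes T square, so every candidate is n x n and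
    the uniqueness lemma applies.\<close>
  have dims: "T \<in> carrier_mat n n" if "psd_mat T" "T * T = M" for T
  proof -
    have "dim_row T = n" using arg_cong[OF that(2), of dim_row] M(1) by simp
    with psd_mat_carrier[OF that(1)] show ?thesis by metis
  qed
  have "psd_mat (psd_sqrt M) \<and> psd_sqrt M * psd_sqrt M = M"
    unfolding psd_sqrt_def
  proof (rule theI[of _ S])
    fix T assume T: "psd_mat T \<and> T * T = M"
    show "T = S" by (rule psd_mat_eq_if_square_eq[OF dims _ S psdS]) (use T SS in auto)
  qed (use psdS SS in auto)
  then show "psd_mat (psd_sqrt M)" "psd_sqrt M * psd_sqrt M = M" "psd_sqrt M \<in> carrier_mat n n"
    using dims by auto
qed

section \<open>Quadratic forms as squared Euclidean norms\<close>

lemma vec_norm2_eq_sqrt: "vec_norm2 v = sqrt (v \<bullet> v)"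
  by (simp add: vec_norm2_def L2_set_def scalar_prod_def lessThan_atLeast0 power2_eq_square)

text \<open>M is split into two copies of its square root, one of which moves to the other side of
  the scalar product because it is symmetric.\<close>

lemma sqrt_quadratic_form_eq_norm:
  assumes M: "M \<in> carrier_mat n n" "psd_mat M" and v: "v \<in> carrier_vec n"
  shows "sqrt (v \<bullet> (M *\<^sub>v v)) = vec_norm2 (psd_sqrt M *\<^sub>v v)"
proof -
  note S = psd_sqrt[OF M]
  have "v \<bullet> (M *\<^sub>v v) = v \<bullet> (psd_sqrt M *\<^sub>v (psd_sqrt M *\<^sub>v v))"
    using S(2,3) v assoc_mult_mat_vec[OF S(3,3) v] by simp
  also have "\<dots> = (psd_sqrt M *\<^sub>v v) \<bullet> (psd_sqrt M *\<^sub>v v)"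
    using transpose_vec_mult_scalar[OF S(3) _ v, of "psd_sqrt M *\<^sub>v v"] S(3) v
      psd_matD(1)[OF S(1,3)] by simp
  finally show ?thesis by (simp add: vec_norm2_eq_sqrt)
qed

section \<open>The augmented system and the equivalence of the two constraints\<close>

lemma aug_cov_carrier: "\<Sigma> \<in> carrier_mat n n \<Longrightarrow> aug_cov n \<Sigma> \<in> carrier_mat (n + n) (n + n)"
  by (simp add: aug_cov_def)

text \<open>With v split into halves a and b, the form reduces to that of the initial covariance at
  b: the constant half of the augmented state has no variance.\<close>

lemma psd_mat_aug_cov:
  assumes \<Sigma>: "\<Sigma> \<in> carrier_mat n n" "psd_mat \<Sigma>"
  shows "psd_mat (aug_cov n \<Sigma>)"
proof (rule psd_matI)
  show "transpose_mat (aug_cov n \<Sigma>) = aug_cov n \<Sigma>"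
    unfolding aug_cov_def using \<Sigma>(1) psd_matD(1)[OF \<Sigma>(2,1)]
    by (subst transpose_four_block_mat[of _ n n _ n _ n]) auto
  fix v :: "real vec" assume v: "v \<in> carrier_vec (n + n)"
  define a b where "a = vec_first v n" and "b = vec_last v n"
  have ab: "a \<in> carrier_vec n" "b \<in> carrier_vec n" "v = a @\<^sub>v b"
    using v by (auto simp: a_def b_def)
  have "aug_cov n \<Sigma> *\<^sub>v v = 0\<^sub>v n @\<^sub>v (\<Sigma> *\<^sub>v b)"
    unfolding aug_cov_def ab(3) using ab \<Sigma>(1)
    by (subst four_block_mat_mult_vec[of _ n n _ n _ n]) auto
  then have "v \<bullet> (aug_cov n \<Sigma> *\<^sub>v v) = b \<bullet> (\<Sigma> *\<^sub>v b)"
    using ab \<Sigma>(1) by (simp add: scalar_prod_append[of _ n _ n])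
  then show "0 \<le> v \<bullet> (aug_cov n \<Sigma> *\<^sub>v v)" using psd_matD(2)[OF \<Sigma>(2,1) ab(2)] by simp
qed (use \<Sigma> aug_cov_carrier in auto)

text \<open>The row count is n for the constant block plus (N + 1) * n for the stacked
  states.\<close>

lemma aug_state_mat_carrier: "aug_state_mat N n A \<in> carrier_mat ((N + 2) * n) (n + n)"
  by (auto simp: aug_state_mat_def stacked_state_mat_def mat_of_blocks_def Let_def)

lemma aug_input_mat_carrier: "aug_input_mat N n m A B \<in> carrier_mat ((N + 2) * n) (N * m)"
  by (auto simp: aug_input_mat_def stacked_input_mat_def mat_of_blocks_def append_rows_def)

theorem theorem1:
  fixes N nx nu nw :: nat
    and A B D :: "nat \<Rightarrow> real mat"
    and \<mu>\<^sub>0 :: "real vec" and \<Sigma>\<^sub>0 K K\<^sub>1 K\<^sub>X :: "real mat"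
    and \<A> \<B> \<D> I \<Sigma>aug \<Sigma>\<^sub>X :: "real mat" and \<mu>aug Xbar :: "real vec"
    and \<alpha> :: "real vec" and \<beta> p :: real
  assumes "N > 0" "nx > 0" "nu > 0" "nw > 0"
    and "\<And>k. k < N \<Longrightarrow> A k \<in> carrier_mat nx nx"
    and "\<And>k. k < N \<Longrightarrow> B k \<in> carrier_mat nx nu"
    and "\<And>k. k < N \<Longrightarrow> D k \<in> carrier_mat nx nw"
    and "\<mu>\<^sub>0 \<in> carrier_vec nx"
    and "\<Sigma>\<^sub>0 \<in> carrier_mat nx nx" and "psd_mat \<Sigma>\<^sub>0"
    and "K\<^sub>1 \<in> carrier_mat (N * nu) nx"
    and "K\<^sub>X \<in> carrier_mat (N * nu) ((N + 1) * nx)"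
    and "lower_block_triangular N (N + 1) nu nx K\<^sub>X"
    and "K = append_cols K\<^sub>1 K\<^sub>X"
    and "\<A> = aug_state_mat N nx A"
    and "\<B> = aug_input_mat N nx nu A B"
    and "\<D> = aug_input_mat N nx nw A D"
    and "I = 1\<^sub>m ((N + 2) * nx)"
    and "\<mu>aug = aug_mean nx \<mu>\<^sub>0"
    and "\<Sigma>aug = aug_cov nx \<Sigma>\<^sub>0"
    and "Xbar = (I + \<B> * K) * \<A> *\<^sub>v \<mu>aug"
    and "\<Sigma>\<^sub>X = (I + \<B> * K) * (\<A> * \<Sigma>aug * transpose_mat \<A> + \<D> * transpose_mat \<D>)
               * transpose_mat (I + \<B> * K)"
    and "\<alpha> \<in> carrier_vec ((N + 2) * nx)"
    and "0 < p" "p < 1"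
  shows "\<alpha> \<bullet> Xbar - \<beta> + sqrt (\<alpha> \<bullet> (\<Sigma>\<^sub>X *\<^sub>v \<alpha>)) * std_normal_quantile (1 - p) \<le> 0
     \<longleftrightarrow> \<alpha> \<bullet> ((I + \<B> * K) * \<A> *\<^sub>v \<mu>aug) - \<beta>
         + vec_norm2 (psd_sqrt (\<A> * \<Sigma>aug * transpose_mat \<A> + \<D> * transpose_mat \<D>)
             *\<^sub>v (transpose_mat (I + \<B> * K) *\<^sub>v \<alpha>)) * std_normal_quantile (1 - p) \<le> 0"
proof -
  let ?n = "(N + 2) * nx"
  let ?M = "\<A> * \<Sigma>aug * transpose_mat \<A> + \<D> * transpose_mat \<D>"
  let ?L = "I + \<B> * K"
  have \<A>: "\<A> \<in> carrier_mat ?n (nx + nx)" and \<B>: "\<B> \<in> carrier_mat ?n (N * nu)"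
    and \<D>: "\<D> \<in> carrier_mat ?n (N * nw)"
    unfolding assms(15-17) by (rule aug_state_mat_carrier aug_input_mat_carrier)+
  have K: "K \<in> carrier_mat (N * nu) ?n"
    unfolding assms(14) append_cols_def using assms(11,12) by auto
  have L: "?L \<in> carrier_mat ?n ?n" using \<B> K by (simp add: assms(18))
  have \<Sigma>aug: "\<Sigma>aug \<in> carrier_mat (nx + nx) (nx + nx)" "psd_mat \<Sigma>aug"
    unfolding assms(20) using assms(9,10) by (auto intro: aug_cov_carrier psd_mat_aug_cov)
  have M: "?M \<in> carrier_mat ?n ?n" using \<A> \<D> \<Sigma>aug(1) by simp
  \<comment> \<open>The initial covariance enters by congruence and the noise as a Gram matrix; both
    terms are positive semidefinite.\<close>
  have psdM: "psd_mat ?M"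
    using \<A> \<D> \<Sigma>aug
    by (intro psd_mat_add[of _ ?n] psd_mat_congruence[OF \<Sigma>aug \<A>] psd_mat_mult_transpose[OF \<D>]) auto
  define v where "v = transpose_mat ?L *\<^sub>v \<alpha>"
  have v: "v \<in> carrier_vec ?n" using L assms(23) by (simp add: v_def)
  \<comment> \<open>The product is applied factor by factor, so that the outer factor I + B K can be
    moved onto \<open>\<alpha>\<close>, where it produces the second copy of v.\<close>
  have "\<Sigma>\<^sub>X *\<^sub>v \<alpha> = ?L *\<^sub>v (?M *\<^sub>v v)"
    unfolding assms(22) v_def using L M assms(23)
    by (simp only: assoc_mult_mat_vec[OF mult_carrier_mat[OF L M]] assoc_mult_mat_vec[OF L M]
        transpose_carrier_mat mult_mat_vec_carrier)
  then have "\<alpha> \<bullet> (\<Sigma>\<^sub>X *\<^sub>v \<alpha>) = v \<bullet> (?M *\<^sub>v v)"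
    unfolding v_def
    using transpose_vec_mult_scalar[OF L mult_mat_vec_carrier[OF M v] assms(23)]
    by (simp add: v_def)
  then have "sqrt (\<alpha> \<bullet> (\<Sigma>\<^sub>X *\<^sub>v \<alpha>)) = vec_norm2 (psd_sqrt ?M *\<^sub>v v)"
    using sqrt_quadratic_form_eq_norm[OF M psdM v] by simp
  \<comment> \<open>The mean terms agree by the definition of \<open>Xbar\<close>. The left-hand
    sides are thus equal numbers, whatever the sign of the quantile.\<close>
  then show ?thesis unfolding assms(21) v_def by simp
qed

end
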